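(* Let $X$ be a proper, geodesically complete $\mathrm{CAT}(0)$ space which admits a cocompact action by isometries. Then $X$ is finite dimensional.
   Context: Proper means all closed balls are compact. $X$ is geodesically complete if every isometric embedding of a compact interval into $X$ extends to an isometric embedding $\mathbb{R}\to X$. "Finite dimensional" means finite Lebesgue covering dimension; $X$ is a separable metric space, so this equals its small and large inductive dimensions, and (for a separable $\mathrm{CAT}(0)$ space) its geometric dimension in the sense of Kleiner. *)

theory Defs
  imports "HOL-Analysis.Analysis" "HOL-Algebra.Group_Action"
begin

text \<open>
  A metric space is a subset \<open>X\<close> of a type of class \<open>metric_space\<close>, with the induced metric;
  \<open>X = UNIV\<close> gives the type itself.
\<close>

definition isometric_embedding :: "'a::metric_space set \<Rightarrow> 'b::metric_space set \<Rightarrow> ('a \<Rightarrow> 'b) \<Rightarrow> bool" where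
  "isometric_embedding S X f \<longleftrightarrow>
     f ` S \<subseteq> X \<and> (\<forall>s\<in>S. \<forall>t\<in>S. dist (f s) (f t) = dist s t)"

definition proper_metric :: "'a::metric_space set \<Rightarrow> bool" where
  "proper_metric X \<longleftrightarrow> (\<forall>x\<in>X. \<forall>r. compact (cball x r \<inter> X))"

definition geodesic_segment :: "'a::metric_space set \<Rightarrow> 'a \<Rightarrow> 'a \<Rightarrow> 'a set \<Rightarrow> bool" where
  "geodesic_segment X a b S \<longleftrightarrow>
     (\<exists>c l. 0 \<le> l \<and> isometric_embedding {0..l::real} X c \<and> c 0 = a \<and> c l = b \<and> S = c ` {0..l})"

definition geodesic_space :: "'a::metric_space set \<Rightarrow> bool" where
  "geodesic_space X \<longleftrightarrow> (\<forall>a\<in>X. \<forall>b\<in>X. \<exists>S. geodesic_segment X a b S)"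

text \<open>
  \<open>x'\<close> is the comparison point, on the side \<open>[a', b']\<close> of the Euclidean comparison triangle, of the
  point \<open>x\<close> of a geodesic segment \<open>S\<close> that issues from \<open>a\<close>.
\<close>

definition comparison_point ::
  "'a::metric_space \<Rightarrow> 'a set \<Rightarrow> real^2 \<Rightarrow> real^2 \<Rightarrow> 'a \<Rightarrow> real^2 \<Rightarrow> bool" where
  "comparison_point a S a' b' x x' \<longleftrightarrow>
     x \<in> S \<and> x' \<in> closed_segment a' b' \<and> dist a' x' = dist a x"

definition CAT0 :: "'a::metric_space set \<Rightarrow> bool" where
  "CAT0 X \<longleftrightarrow> geodesic_space X \<and>
     (\<forall>p\<in>X. \<forall>q\<in>X. \<forall>r\<in>X. \<forall>S\<^sub>1 S\<^sub>2 S\<^sub>3. \<forall>p' q' r'.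
        geodesic_segment X p q S\<^sub>1 \<and> geodesic_segment X q r S\<^sub>2 \<and> geodesic_segment X r p S\<^sub>3 \<and>
        dist p' q' = dist p q \<and> dist q' r' = dist q r \<and> dist r' p' = dist r p \<longrightarrow>
        (\<forall>x y x' y'.
           (comparison_point p S\<^sub>1 p' q' x x' \<or> comparison_point q S\<^sub>2 q' r' x x' \<or>
            comparison_point r S\<^sub>3 r' p' x x') \<and>
           (comparison_point p S\<^sub>1 p' q' y y' \<or> comparison_point q S\<^sub>2 q' r' y y' \<or>
            comparison_point r S\<^sub>3 r' p' y y') \<longrightarrow>
           dist x y \<le> dist x' y'))"

text \<open>
  Only nondegenerate intervals are considered, so that a one-point space is geodesically complete.
  For all other geodesic spaces it makes no difference if \<open>a = b\<close> is allowed too.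
\<close>

definition geodesically_complete :: "'a::metric_space set \<Rightarrow> bool" where
  "geodesically_complete X \<longleftrightarrow>
     (\<forall>(a::real) b c. a < b \<and> isometric_embedding {a..b} X c \<longrightarrow>
        (\<exists>c'. isometric_embedding UNIV X c' \<and> (\<forall>t\<in>{a..b}. c' t = c t)))"

definition isometric_action ::
  "('g, 'm) monoid_scheme \<Rightarrow> 'a::metric_space set \<Rightarrow> ('g \<Rightarrow> 'a \<Rightarrow> 'a) \<Rightarrow> bool" where
  "isometric_action G X \<phi> \<longleftrightarrow>
     group_action G X \<phi> \<and> (\<forall>g\<in>carrier G. isometric_embedding X X (\<phi> g))"

definition cocompact_action ::
  "('g, 'm) monoid_scheme \<Rightarrow> 'a::metric_space set \<Rightarrow> ('g \<Rightarrow> 'a \<Rightarrow> 'a) \<Rightarrow> bool" where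
  "cocompact_action G X \<phi> \<longleftrightarrow>
     (\<exists>K. K \<subseteq> X \<and> compact K \<and> X = (\<Union>g\<in>carrier G. \<phi> g ` K))"

text \<open>Lebesgue covering dimension at most \<open>n\<close>: refinements in which no point lies in more than
  \<open>n + 1\<close> members.\<close>

definition covering_dim_le :: "'a topology \<Rightarrow> nat \<Rightarrow> bool" where
  "covering_dim_le T n \<longleftrightarrow>
     (\<forall>\<U>. (\<forall>U\<in>\<U>. openin T U) \<and> \<Union>\<U> = topspace T \<longrightarrow>
        (\<exists>\<V>. (\<forall>V\<in>\<V>. openin T V) \<and> \<Union>\<V> = topspace T \<and>
             (\<forall>V\<in>\<V>. \<exists>U\<in>\<U>. V \<subseteq> U) \<and>
             (\<forall>x\<in>topspace T. finite {V\<in>\<V>. x \<in> V} \<and> card {V\<in>\<V>. x \<in> V} \<le> n + 1)))"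

definition finite_dimensional :: "'a topology \<Rightarrow> bool" where
  "finite_dimensional T \<longleftrightarrow> (\<exists>n. covering_dim_le T n)"

end

theory Submission imports Defs begin

text \<open>
  Let \<open>s, t\<close> lie in a small ball about \<open>x\<close>.  Prolonging the geodesics \<open>[x, s]\<close> and \<open>[x, t]\<close> by
  a factor \<open>\<mu> \<ge> 1\<close> multiplies the distance of their endpoints by at least \<open>\<mu>\<close>, by the CAT(0)
  inequality.  Hence the packing numbers of a ball of radius \<open>3r\<close> at scale \<open>r/2\<close>, for \<open>r \<le> 1\<close>,
  are bounded by those of a ball of radius \<open>3\<close> at scale \<open>1/2\<close>, and the latter are bounded uniformly
  in the centre by cocompactness and properness.  Such a bound \<open>N\<close> on packing numbers at all small
  scales forces finite covering dimension: choose a slowly varying radius function \<open>\<rho>\<close>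
  subordinate to a given open cover and a maximal \<open>\<rho>\<close>-separated set \<open>A\<close>; the balls
  \<open>B(a, 2\<rho>(a))\<close> with \<open>a \<in> A\<close> refine the cover and at most \<open>N\<close> of them meet in a point.
\<close>

abbreviation separated :: "real \<Rightarrow> 'a::metric_space set \<Rightarrow> bool" where
  "separated \<epsilon> S \<equiv> pairwise (\<lambda>s t. \<epsilon> \<le> dist s t) S"

section \<open>Bounded packing numbers and covering dimension\<close>

text \<open>Take for \<open>L x\<close> the supremum of the radii r \<le> 1 whose ball about x lies
  in one member of the cover. The ball about y of radius \<open>r - dist x y\<close> lies inside
  \<open>ball x r\<close>, which makes \<open>L\<close> 1-Lipschitz. The cap 1 keeps the supremum
  finite even when a member of the cover is all of \<open>X\<close>.\<close>

lemma subordinate_radius_function: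
  fixes X :: "'a::metric_space set"
  assumes opn: "\<And>U. U \<in> \<U> \<Longrightarrow> openin (top_of_set X) U" and cov: "\<Union>\<U> = X"
  obtains L :: "'a \<Rightarrow> real"
  where "\<And>x. x \<in> X \<Longrightarrow> 0 < L x" "\<And>x. x \<in> X \<Longrightarrow> L x \<le> 1"
    "\<And>x y. x \<in> X \<Longrightarrow> y \<in> X \<Longrightarrow> L x \<le> L y + dist x y"
    "\<And>x r. x \<in> X \<Longrightarrow> r < L x \<Longrightarrow> \<exists>U\<in>\<U>. ball x r \<inter> X \<subseteq> U"
proof
  define R where "R x = {r. 0 < r \<and> r \<le> 1 \<and> (\<exists>U\<in>\<U>. ball x r \<inter> X \<subseteq> U)}" for x
  define L where "L x = Sup (R x)" for x
  have bdd: "bdd_above (R x)" for x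
    by (rule bdd_aboveI[of _ 1]) (auto simp: R_def)
  have ne: "R x \<noteq> {}" if "x \<in> X" for x
  proof -
    from that cov obtain U where U: "U \<in> \<U>" "x \<in> U" by blast
    with opn obtain e where e: "e > 0" "ball x e \<inter> X \<subseteq> U"
      by (metis openin_contains_ball)
    have "ball x (min e 1) \<inter> X \<subseteq> U" using e(2) by auto
    then have "min e 1 \<in> R x" using e(1) U(1) by (auto simp: R_def)
    then show ?thesis by blast
  qed
  show pos: "0 < L x" if "x \<in> X" for x
  proof -
    from ne[OF that] obtain r where r: "r \<in> R x" by blast
    then have "r \<le> L x" unfolding L_def by (rule cSup_upper[OF _ bdd])
    with r show ?thesis by (auto simp: R_def)
  qed
  show "L x \<le> 1" if "x \<in> X" for x
    unfolding L_def by (rule cSup_least[OF ne[OF that]]) (auto simp: R_def)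
  show "L x \<le> L y + dist x y" if "x \<in> X" "y \<in> X" for x y
    unfolding L_def[of x]
  proof (rule cSup_least[OF ne[OF that(1)]])
    fix r assume r: "r \<in> R x"
    show "r \<le> L y + dist x y"
    proof (cases "dist x y < r")
      case True
      have "ball y (r - dist x y) \<subseteq> ball x r"
        using dist_triangle[of x _ y] by (force simp: less_diff_eq intro: le_less_trans)
      with r True have "r - dist x y \<in> R y"
        unfolding R_def using zero_le_dist[of x y] by (auto simp del: zero_le_dist)
      then have "r - dist x y \<le> L y"
        unfolding L_def by (rule cSup_upper[OF _ bdd])
      then show ?thesis by simp
    next
      case False
      then show ?thesis using pos[OF that(2)] by simp
    qed
  qed
  show "\<exists>U\<in>\<U>. ball x r \<inter> X \<subseteq> U" if "x \<in> X" "r < L x" for x r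
  proof -
    from that obtain r' where r': "r' \<in> R x" "r < r'"
      unfolding L_def by (meson less_cSupD ne)
    then obtain U where U: "U \<in> \<U>" "ball x r' \<inter> X \<subseteq> U" unfolding R_def by blast
    have "ball x r \<subseteq> ball x r'" using r'(2) by auto
    with U show ?thesis by blast
  qed
qed

text \<open>Zorn's lemma: two points of the union of a chain already lie in a common member of the
  chain, so \<open>pairwise P\<close> passes to the union. Symmetry lets a point that is related to
  all of a maximal set be inserted into it.\<close>

lemma maximal_pairwise_subset:
  assumes sym: "\<And>x y. P x y \<Longrightarrow> P y x"
  obtains A where "A \<subseteq> X" "pairwise P A" "\<And>x. x \<in> X \<Longrightarrow> x \<in> A \<or> (\<exists>a\<in>A. \<not> P a x)"
proof -
  define \<A> where "\<A> = {A. A \<subseteq> X \<and> pairwise P A}"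
  have "\<exists>M\<in>\<A>. \<forall>B\<in>\<A>. M \<subseteq> B \<longrightarrow> B = M"
  proof (rule subset_Zorn_nonempty)
    show "\<A> \<noteq> {}" by (auto simp: \<A>_def intro: exI[of _ "{}"])
    fix \<C> assume "\<C> \<noteq> {}" "subset.chain \<A> \<C>"
    then have sub: "\<C> \<subseteq> \<A>" and chain: "\<And>A B. A \<in> \<C> \<Longrightarrow> B \<in> \<C> \<Longrightarrow> A \<subseteq> B \<or> B \<subseteq> A"
      by (auto simp: subset_chain_def)
    have "P x y" if "x \<in> A" "A \<in> \<C>" "y \<in> B" "B \<in> \<C>" "x \<noteq> y" for x y A B
      using chain[OF that(2,4)] that sub unfolding \<A>_def pairwise_def by blast
    then have "pairwise P (\<Union>\<C>)" unfolding pairwise_def by blast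
    with sub show "\<Union>\<C> \<in> \<A>" by (auto simp: \<A>_def)
  qed
  then obtain M where M: "M \<subseteq> X" "pairwise P M"
    and max: "\<And>B. B \<subseteq> X \<Longrightarrow> pairwise P B \<Longrightarrow> M \<subseteq> B \<Longrightarrow> B = M"
    unfolding \<A>_def by auto
  have "x \<in> M \<or> (\<exists>a\<in>M. \<not> P a x)" if "x \<in> X" for x
  proof (rule ccontr)
    assume *: "\<not> ?thesis"
    then have "pairwise P (insert x M)"
      using M(2) sym by (auto simp: pairwise_insert)
    with max[of "insert x M"] M(1) that * show False by blast
  qed
  with M that show thesis by blast
qed

lemma covering_dim_le_if_packing_bounded:
  fixes X :: "'a::metric_space set"
  assumes pack: "\<And>x r S. x \<in> X \<Longrightarrow> 0 < r \<Longrightarrow> r \<le> 1 \<Longrightarrow> finite S \<Longrightarrow> S \<subseteq> cball x (3 * r) \<inter> X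
                   \<Longrightarrow> separated (r / 2) S \<Longrightarrow> card S \<le> N"
  shows "covering_dim_le (top_of_set X) N"
  unfolding covering_dim_le_def
proof (intro allI impI, elim conjE)
  fix \<U> assume opn: "\<forall>U\<in>\<U>. openin (top_of_set X) U" and cov: "\<Union>\<U> = topspace (top_of_set X)"
  obtain L :: "'a \<Rightarrow> real" where L: "\<And>x. x \<in> X \<Longrightarrow> 0 < L x" "\<And>x. x \<in> X \<Longrightarrow> L x \<le> 1"
    "\<And>x y. x \<in> X \<Longrightarrow> y \<in> X \<Longrightarrow> L x \<le> L y + dist x y"
    "\<And>x r. x \<in> X \<Longrightarrow> r < L x \<Longrightarrow> \<exists>U\<in>\<U>. ball x r \<inter> X \<subseteq> U"
    by (rule subordinate_radius_function[of \<U> X]) (use opn cov in auto)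
  \<comment> \<open>The factor 10 ensures 2 \<rho> < \<open>L\<close>, so that the balls
    \<open>V a\<close> below refine the cover. It also makes \<rho> Lipschitz with constant 1/10, so
    \<rho> changes only by a bounded factor across such a ball.\<close>
  define \<rho> where "\<rho> x = L x / 10" for x
  have pos: "0 < \<rho> x" "\<rho> x \<le> 1" if "x \<in> X" for x
    using L(1,2)[OF that] by (auto simp: \<rho>_def)
  have lip: "10 * \<rho> x \<le> 10 * \<rho> y + dist x y" if "x \<in> X" "y \<in> X" for x y
    using L(3)[OF that] by (simp add: \<rho>_def)
  obtain A where A: "A \<subseteq> X" "pairwise (\<lambda>a b. \<rho> a \<le> dist a b \<and> \<rho> b \<le> dist a b) A"
    and max: "\<And>x. x \<in> X \<Longrightarrow> x \<in> A \<or> (\<exists>a\<in>A. \<not> (\<rho> a \<le> dist a x \<and> \<rho> x \<le> dist a x))"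
    by (rule maximal_pairwise_subset[of "\<lambda>a b. \<rho> a \<le> dist a b \<and> \<rho> b \<le> dist a b" X])
       (auto simp: dist_commute)
  define V where "V a = ball a (2 * \<rho> a) \<inter> X" for a
  have covers: "\<exists>a\<in>A. x \<in> V a" if x: "x \<in> X" for x
    using max[OF x]
  proof
    assume "x \<in> A"
    then show ?thesis using x pos[OF x] by (intro bexI[of _ x]) (auto simp: V_def)
  next
    assume "\<exists>a\<in>A. \<not> (\<rho> a \<le> dist a x \<and> \<rho> x \<le> dist a x)"
    then obtain a where a: "a \<in> A" "\<not> (\<rho> a \<le> dist a x \<and> \<rho> x \<le> dist a x)" by blast
    \<comment> \<open>If \<open>dist a x < \<rho> x\<close>, the Lipschitz bound gives 9 \<rho>(x)
      \<le> 10 \<rho>(a), hence the claim; the other case is immediate.\<close>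
    then have "dist a x < 2 * \<rho> a"
      using lip[OF x, of a] pos[of a] A(1) by (auto simp: dist_commute)
    with a x show ?thesis by (auto simp: V_def)
  qed
  have mult: "finite {a\<in>A. x \<in> V a} \<and> card {a\<in>A. x \<in> V a} \<le> N" if x: "x \<in> X" for x
  \<comment> \<open>Finiteness is not known beforehand; a uniform bound on the finite subsets gives
    it together with the cardinality bound.\<close>
  proof (rule finite_if_finite_subsets_card_bdd)
    fix S assume S: "S \<subseteq> {a\<in>A. x \<in> V a}" "finite S"
    have near: "a \<in> X" "dist x a \<le> 3 * \<rho> x" "\<rho> x / 2 \<le> \<rho> a" if "a \<in> S" for a
    proof -
      show a: "a \<in> X" using that S A by blast
      have "dist a x < 2 * \<rho> a" using that S by (auto simp: V_def)
      \<comment> \<open>The Lipschitz bound in both directions gives 8 \<rho>(a) < 10 \<rho>(x) and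
        10 \<rho>(x) < 12 \<rho>(a). This is the origin of the radius 3r and the scale r/2 in the
        packing hypothesis.\<close>
      then show "dist x a \<le> 3 * \<rho> x" "\<rho> x / 2 \<le> \<rho> a"
        using lip[OF x a] lip[OF a x] pos[OF a] by (auto simp: dist_commute)
    qed
    show "card S \<le> N"
    proof (rule pack[OF x pos[OF x] S(2)])
      show "S \<subseteq> cball x (3 * \<rho> x) \<inter> X" using near by auto
      have "pairwise (\<lambda>a b. \<rho> a \<le> dist a b \<and> \<rho> b \<le> dist a b) S"
        using A(2) S(1) by (auto intro: pairwise_subset)
      then show "separated (\<rho> x / 2) S"
        using near(3) unfolding pairwise_def by (meson order_trans)
    qed
  qed
  show "\<exists>\<V>. (\<forall>V\<in>\<V>. openin (top_of_set X) V) \<and> \<Union>\<V> = topspace (top_of_set X) \<and>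
          (\<forall>V\<in>\<V>. \<exists>U\<in>\<U>. V \<subseteq> U) \<and>
          (\<forall>x\<in>topspace (top_of_set X). finite {V\<in>\<V>. x \<in> V} \<and> card {V\<in>\<V>. x \<in> V} \<le> N + 1)"
  proof (intro exI[of _ "V ` A"] conjI ballI)
    show "openin (top_of_set X) W" if "W \<in> V ` A" for W
      using that by (auto simp: V_def openin_open_Int Int_commute[of _ X])
    show "\<Union>(V ` A) = topspace (top_of_set X)"
      using covers by (auto simp: V_def)
    show "\<exists>U\<in>\<U>. W \<subseteq> U" if W: "W \<in> V ` A" for W
    proof -
      from W obtain a where a: "a \<in> A" "W = V a" by blast
      then have "a \<in> X" using A by blast
      then show ?thesis using L(1,4)[of a] by (auto simp: a V_def \<rho>_def)
    qed
    fix x assume "x \<in> topspace (top_of_set X)"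
    then have x: "finite {a\<in>A. x \<in> V a}" "card {a\<in>A. x \<in> V a} \<le> N" using mult by auto
    \<comment> \<open>Different centres may give the same set, so members are counted as an image of
      the centres and there are at most \<open>N\<close> of them.\<close>
    have eq: "{W \<in> V ` A. x \<in> W} = V ` {a\<in>A. x \<in> V a}" by blast
    show "finite {W \<in> V ` A. x \<in> W}" unfolding eq using x(1) by blast
    show "card {W \<in> V ` A. x \<in> W} \<le> N + 1"
      unfolding eq using card_image_le[OF x(1), of V] x(2) by linarith
  qed
qed

section \<open>Packing numbers of balls of a fixed radius\<close>

text \<open>Pigeonhole: cover \<open>C\<close> by finitely many balls of radius \<epsilon>/2; each
  of them contains at most one point of an \<epsilon>-separated set.\<close>

lemma compact_packing_bound:
  fixes C :: "'a::metric_space set"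
  assumes "compact C" "0 < \<epsilon>"
  obtains N where "\<And>S. S \<subseteq> C \<Longrightarrow> separated \<epsilon> S \<Longrightarrow> card S \<le> N"
proof -
  have "0 < \<epsilon> / 2" using assms by simp
  with assms(1) obtain F where F: "finite F" "C \<subseteq> (\<Union>x\<in>F. ball x (\<epsilon> / 2))"
    unfolding compact_eq_totally_bounded by meson
  have "card S \<le> card F" if S: "S \<subseteq> C" "separated \<epsilon> S" for S
  proof -
    have "\<forall>s\<in>S. \<exists>x\<in>F. dist x s < \<epsilon> / 2" using S(1) F(2) by fastforce
    then obtain f where f: "\<And>s. s \<in> S \<Longrightarrow> f s \<in> F" "\<And>s. s \<in> S \<Longrightarrow> dist (f s) s < \<epsilon> / 2"
      by metis
    have "inj_on f S"
    proof (rule inj_onI, rule ccontr)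
      fix s t assume st: "s \<in> S" "t \<in> S" "f s = f t" "s \<noteq> t"
      then have "\<epsilon> \<le> dist s t" using S(2) by (auto simp: pairwise_def)
      moreover have "dist s t < \<epsilon>"
        using f(2)[OF st(1)] f(2)[OF st(2)] st(3) dist_triangle3[of s t "f s"] by simp
      ultimately show False by simp
    qed
    then show ?thesis using F(1) f(1) by (auto intro: card_inj_on_le)
  qed
  then show thesis using that by blast
qed

text \<open>Serves both for isometries and for the expanding map along geodesics. Positivity of
  \<epsilon> is what makes \<open>f\<close> injective on \<open>S\<close>.\<close>

lemma separated_image_expanding:
  assumes "0 < \<epsilon>" "separated \<delta> S" "\<And>s t. s \<in> S \<Longrightarrow> t \<in> S \<Longrightarrow> \<delta> \<le> dist s t \<Longrightarrow> \<epsilon> \<le> dist (f s) (f t)"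
  shows "separated \<epsilon> (f ` S)" "card (f ` S) = card S"
proof -
  have *: "\<epsilon> \<le> dist (f s) (f t)" if "s \<in> S" "t \<in> S" "s \<noteq> t" for s t
    using assms that by (auto simp: pairwise_def)
  show "separated \<epsilon> (f ` S)" using * unfolding pairwise_def by blast
  have "inj_on f S" by (rule inj_onI, rule ccontr) (use * assms(1) in force)
  then show "card (f ` S) = card S" by (rule card_image)
qed

text \<open>Every centre is a translate of a point of the compact set \<open>K\<close>. Undoing the
  translation moves the packing isometrically into one fixed ball about \<open>k\<^sub>0\<close>,
  which is compact by properness.\<close>

lemma cocompact_packing_bound:
  fixes X :: "'a::metric_space set"
  assumes "proper_metric X" "isometric_action G X \<phi>" "cocompact_action G X \<phi>" "0 < \<epsilon>"
  obtains N where "\<And>x S. x \<in> X \<Longrightarrow> S \<subseteq> cball x R \<inter> X \<Longrightarrow> separated \<epsilon> S \<Longrightarrow> card S \<le> N"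
proof -
  from assms(3) obtain K where K: "K \<subseteq> X" "compact K" "X = (\<Union>g\<in>carrier G. \<phi> g ` K)"
    unfolding cocompact_action_def by blast
  show thesis
  proof (cases "K = {}")
    case True
    then show thesis using that K(3) by auto
  next
    case False
    then obtain k\<^sub>0 where k0: "k\<^sub>0 \<in> K" by blast
    obtain D where D: "\<And>k. k \<in> K \<Longrightarrow> dist k\<^sub>0 k \<le> D"
      using compact_imp_bounded[OF K(2)] by (auto simp: bounded_any_center[of _ k\<^sub>0])
    have "compact (cball k\<^sub>0 (D + R) \<inter> X)"
      using assms(1) k0 K(1) unfolding proper_metric_def by blast
    then obtain N where
      N: "\<And>S. S \<subseteq> cball k\<^sub>0 (D + R) \<inter> X \<Longrightarrow> separated \<epsilon> S \<Longrightarrow> card S \<le> N"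
      using assms(4) by (rule compact_packing_bound) blast
    have "card S \<le> N" if S: "x \<in> X" "S \<subseteq> cball x R \<inter> X" "separated \<epsilon> S" for x S
    proof -
      from S(1) K(3) obtain g k where g: "g \<in> carrier G" "k \<in> K" "x = \<phi> g k" by auto
      have iso: "dist (\<phi> g u) (\<phi> g v) = dist u v" if "u \<in> X" "v \<in> X" for u v
        using assms(2) g(1) that unfolding isometric_action_def isometric_embedding_def by blast
      have surj: "\<phi> g ` X = X"
        using assms(2) g(1) unfolding isometric_action_def by (meson group_action.surj_prop)
      \<comment> \<open>The isometry that undoes the translation, obtained as a right inverse of the
        surjection \<open>\<phi> g\<close> on \<open>X\<close>.\<close>
      define h where "h = inv_into X (\<phi> g)"
      have h: "h y \<in> X" "\<phi> g (h y) = y" if "y \<in> X" for y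
        using that surj unfolding h_def by (auto intro: inv_into_into f_inv_into_f)
      have hiso: "dist (h u) (h v) = dist u v" if "u \<in> X" "v \<in> X" for u v
        using iso[of "h u" "h v"] h that by simp
      have "h ` S \<subseteq> cball k\<^sub>0 (D + R) \<inter> X"
      proof (rule image_subsetI)
        fix s assume "s \<in> S"
        then have s: "s \<in> X" "dist x s \<le> R" using S(2) by auto
        have "dist k (h s) = dist x s"
          using iso[of k "h s"] h[OF s(1)] g K(1) by auto
        then have "dist k\<^sub>0 (h s) \<le> D + R"
          using D[OF g(2)] s(2) dist_triangle[of k\<^sub>0 "h s" k] by simp
        then show "h s \<in> cball k\<^sub>0 (D + R) \<inter> X" using h(1)[OF s(1)] by simp
      qed
      moreover have "separated \<epsilon> (h ` S)" "card (h ` S) = card S"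
        by (rule separated_image_expanding[OF assms(4) S(3)]; use hiso S(2) in force)+
      ultimately show ?thesis using N by metis
    qed
    then show thesis using that by blast
  qed
qed

section \<open>Prolonging geodesics\<close>

text \<open>Put p' at the origin, q' on the first axis and r' = (u, v); two circle equations for (u,
  v) remain, solvable by the triangle inequalities.\<close>

lemma comparison_triangle_exists:
  fixes p q r :: "'a::metric_space"
  obtains p' q' r' :: "real^2"
  where "dist p' q' = dist p q" "dist q' r' = dist q r" "dist r' p' = dist r p"
proof -
  let ?a = "dist p q" and ?b = "dist q r" and ?c = "dist r p"
  have norm2: "norm (vector [u, v] :: real^2) = sqrt (u\<^sup>2 + v\<^sup>2)" for u v :: real
    by (simp add: norm_vec_def L2_set_def sum_2)
  have "\<exists>u v. u\<^sup>2 + v\<^sup>2 = ?c\<^sup>2 \<and> (u - ?a)\<^sup>2 + v\<^sup>2 = ?b\<^sup>2"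
  proof (cases "?a = 0")
    case True
    then have "?c\<^sup>2 + 0\<^sup>2 = ?c\<^sup>2 \<and> (?c - ?a)\<^sup>2 + 0\<^sup>2 = ?b\<^sup>2" by (simp add: dist_commute)
    then show ?thesis by blast
  next
    case False
    \<comment> \<open>Law of cosines, from subtracting the two equations. The triangle inequalities
      amount to \<bar>u\<bar> \<le> \<open>?c\<close>, so v can be the square root of
      \<open>?c\<^sup>2 - u\<^sup>2\<close>.\<close>
    define u where "u = (?a\<^sup>2 + ?c\<^sup>2 - ?b\<^sup>2) / (2 * ?a)"
    have a: "0 < ?a" using False by simp
    have "\<bar>?a - ?c\<bar> \<le> ?b"
      using dist_triangle[of p q r] dist_triangle[of r p q] by (simp add: dist_commute)
    then have "(?a - ?c)\<^sup>2 \<le> ?b\<^sup>2" by (simp add: abs_le_square_iff[symmetric])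
    then have up: "u \<le> ?c"
      using a by (simp add: u_def field_simps power2_eq_square)
    have "?b\<^sup>2 \<le> (?a + ?c)\<^sup>2"
      using dist_triangle[of q r p] by (intro power_mono) (simp_all add: dist_commute)
    then have lo: "- ?c \<le> u"
      using a by (simp add: u_def field_simps power2_eq_square)
    have "u\<^sup>2 \<le> ?c\<^sup>2" using up lo by (simp add: abs_le_square_iff[symmetric])
    moreover have "2 * ?a * u = ?a\<^sup>2 + ?c\<^sup>2 - ?b\<^sup>2" using a by (simp add: u_def)
    ultimately have "u\<^sup>2 + (sqrt (?c\<^sup>2 - u\<^sup>2))\<^sup>2 = ?c\<^sup>2 \<and> (u - ?a)\<^sup>2 + (sqrt (?c\<^sup>2 - u\<^sup>2))\<^sup>2 = ?b\<^sup>2"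
      by (simp add: power2_diff algebra_simps)
    then show ?thesis by blast
  qed
  then obtain u v where uv: "u\<^sup>2 + v\<^sup>2 = ?c\<^sup>2" "(u - ?a)\<^sup>2 + v\<^sup>2 = ?b\<^sup>2" by blast
  show thesis
  proof
    have "vector [u, v] - vector [?a, 0] = (vector [u - ?a, v] :: real^2)"
      by (simp add: vec_eq_iff forall_2)
    then show "dist (vector [?a, 0] :: real^2) (vector [u, v]) = ?b"
      by (simp add: dist_norm norm_minus_commute[of "vector [?a, 0]"] norm2 uv)
    show "dist 0 (vector [?a, 0] :: real^2) = ?a" by (simp add: norm2)
    show "dist (vector [u, v] :: real^2) 0 = ?c" by (simp add: norm2 uv)
  qed
qed

text \<open>Compare with the points at fraction t of the two Euclidean sides issuing from p'. There,
  similar triangles turn the inequality into an equality.\<close>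

lemma CAT0_geodesics_diverge:
  fixes c d :: "real \<Rightarrow> 'a::metric_space"
  assumes X: "CAT0 X"
    and c: "isometric_embedding {0..l} X c" and d: "isometric_embedding {0..m} X d"
    and start: "c 0 = d 0" and nonneg: "0 \<le> l" "0 \<le> m" and t: "0 \<le> t" "t \<le> 1"
  shows "dist (c (t * l)) (d (t * m)) \<le> t * dist (c l) (d m)"
proof -
  define p q r where pqr: "p = c 0" "q = c l" "r = d m"
  have in_X: "p \<in> X" "q \<in> X" "r \<in> X"
    using c d nonneg by (auto simp: pqr isometric_embedding_def)
  have tl: "0 \<le> t * l" "t * l \<le> l" and tm: "0 \<le> t * m" "t * m \<le> m"
    using nonneg t by (auto intro: mult_left_le_one_le)
  have dc: "dist (c x) (c y) = \<bar>x - y\<bar>" if "x \<in> {0..l}" "y \<in> {0..l}" for x y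
    using c that by (auto simp: isometric_embedding_def dist_real_def)
  have dd: "dist (d x) (d y) = \<bar>x - y\<bar>" if "x \<in> {0..m}" "y \<in> {0..m}" for x y
    using d that by (auto simp: isometric_embedding_def dist_real_def)
  have dpq: "dist p q = l" and drp: "dist r p = m"
    using dc[of 0 l] dd[of m 0] nonneg start by (auto simp: pqr)
  have S1: "geodesic_segment X p q (c ` {0..l})"
    unfolding geodesic_segment_def pqr using c nonneg by blast
  obtain S\<^sub>2 where S2: "geodesic_segment X q r S\<^sub>2"
    using X in_X unfolding CAT0_def geodesic_space_def by blast
  \<comment> \<open>\<open>CAT0\<close> runs round the triangle, so its third side goes from r to p.
    Hence \<open>d\<close> is reversed, and the comparison point on that side is later measured from
    r, at distance (1 - t) m.\<close>
  have rev: "(\<lambda>x. m - x) ` {0..m} = {0..m}" by simp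
  have S3: "geodesic_segment X r p (d ` {0..m})"
    unfolding geodesic_segment_def
  proof (intro exI conjI)
    show "isometric_embedding {0..m} X (\<lambda>x. d (m - x))"
      using d by (fastforce simp: isometric_embedding_def dist_real_def)
    show "d ` {0..m} = (\<lambda>x. d (m - x)) ` {0..m}"
      using rev by (simp add: image_image[symmetric, of d "\<lambda>x. m - x"])
  qed (use nonneg start pqr in auto)
  obtain p' q' r' :: "real^2" where
    tri: "dist p' q' = dist p q" "dist q' r' = dist q r" "dist r' p' = dist r p"
    by (rule comparison_triangle_exists)
  define x' y' where xy: "x' = p' + t *\<^sub>R (q' - p')" "y' = p' + t *\<^sub>R (r' - p')"
  have cx: "comparison_point p (c ` {0..l}) p' q' (c (t * l)) x'"
    unfolding comparison_point_def
  proof (intro conjI)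
    show "c (t * l) \<in> c ` {0..l}" using tl by simp
    show "x' \<in> closed_segment p' q'"
      using t by (auto simp: xy in_segment algebra_simps)
    have "dist p' x' = t * dist p' q'" using t by (simp add: xy dist_norm norm_minus_commute)
    also have "\<dots> = dist p (c (t * l))"
      using dc[of 0 "t * l"] tl nonneg tri(1) dpq by (simp add: pqr)
    finally show "dist p' x' = dist p (c (t * l))" .
  qed
  have cy: "comparison_point r (d ` {0..m}) r' p' (d (t * m)) y'"
    unfolding comparison_point_def
  proof (intro conjI)
    show "d (t * m) \<in> d ` {0..m}" using tm by simp
    show "y' \<in> closed_segment r' p'"
      using t by (auto simp: xy in_segment algebra_simps intro!: exI[of _ "1 - t"])
    have "r' - y' = (1 - t) *\<^sub>R (r' - p')" by (simp add: xy algebra_simps)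
    then have "dist r' y' = (1 - t) * dist r' p'" using t by (simp add: dist_norm)
    also have "\<dots> = dist r (d (t * m))"
      using dd[of m "t * m"] tm nonneg tri(3) drp by (simp add: pqr algebra_simps)
    finally show "dist r' y' = dist r (d (t * m))" .
  qed
  have "dist (c (t * l)) (d (t * m)) \<le> dist x' y'"
    using X in_X S1 S2 S3 tri cx cy unfolding CAT0_def by blast
  also have "x' - y' = t *\<^sub>R (q' - r')" by (simp add: xy algebra_simps)
  then have "dist x' y' = t * dist q' r'" using t by (simp add: dist_norm)
  finally show ?thesis by (simp add: tri(2) pqr)
qed

lemma geodesic_prolongation:
  fixes X :: "'a::metric_space set"
  assumes "geodesic_space X" "geodesically_complete X" "x \<in> X" "s \<in> X" "1 \<le> \<mu>"
  obtains c where "isometric_embedding {0..\<mu> * dist x s} X c" "c 0 = x" "c (dist x s) = s"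
proof (cases "x = s")
  \<comment> \<open>Geodesic completeness extends only nondegenerate intervals; here the required
    domain is the single point 0 and a constant map does.\<close>
  case True
  then show thesis using that[of "\<lambda>_. x"] assms by (auto simp: isometric_embedding_def)
next
  case False
  obtain c and l :: real where c: "0 \<le> l" "isometric_embedding {0..l} X c" "c 0 = x" "c l = s"
    using assms(1,3,4) unfolding geodesic_space_def geodesic_segment_def by blast
  then have l: "dist x s = l"
    by (auto simp: isometric_embedding_def dist_real_def)
  then have "0 < l" using False by (metis zero_less_dist_iff)
  then obtain c' where c': "isometric_embedding UNIV X c'" "\<forall>t\<in>{0..l}. c' t = c t"
    using assms(2) c(2) unfolding geodesically_complete_def by blast
  show thesis
  proof (rule that[of c'])
    show "isometric_embedding {0..\<mu> * dist x s} X c'"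
      using c'(1) unfolding isometric_embedding_def by blast
  qed (use c' c l in auto)
qed

text \<open>Push each point of \<open>S\<close> outward along a prolonged geodesic from x until its
  distance from x is multiplied by \<mu>. Prolongations need not be unique, but any choice works,
  since the divergence inequality only asks for a common starting point.\<close>

lemma packing_rescaling:
  fixes X :: "'a::metric_space set"
  assumes X: "CAT0 X" "geodesically_complete X" and x: "x \<in> X" and \<mu>: "1 \<le> \<mu>"
    and S: "S \<subseteq> cball x R \<inter> X" "separated \<epsilon> S" and \<epsilon>: "0 < \<epsilon>"
  obtains T where "T \<subseteq> cball x (\<mu> * R) \<inter> X" "separated (\<mu> * \<epsilon>) T" "card T = card S"
proof -
  have geo: "geodesic_space X" using X(1) by (simp add: CAT0_def)
  have "\<exists>c. isometric_embedding {0..\<mu> * dist x s} X c \<and> c 0 = x \<and> c (dist x s) = s"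
    if "s \<in> S" for s
  proof -
    have "s \<in> X" using that S(1) by blast
    then show ?thesis by (rule geodesic_prolongation[OF geo X(2) x _ \<mu>]) blast
  qed
  then obtain c where c: "\<And>s. s \<in> S \<Longrightarrow> isometric_embedding {0..\<mu> * dist x s} X (c s)"
    "\<And>s. s \<in> S \<Longrightarrow> c s 0 = x" "\<And>s. s \<in> S \<Longrightarrow> c s (dist x s) = s" by metis
  define f where "f s = c s (\<mu> * dist x s)" for s
  have expand: "\<mu> * dist s t \<le> dist (f s) (f t)" if "s \<in> S" "t \<in> S" for s t
  proof -
    \<comment> \<open>Divergence at the fraction 1/\<mu> of the prolonged geodesics, where they pass
      through s and t.\<close>
    have "dist (c s (1 / \<mu> * (\<mu> * dist x s))) (c t (1 / \<mu> * (\<mu> * dist x t)))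
            \<le> 1 / \<mu> * dist (f s) (f t)"
      unfolding f_def
      by (rule CAT0_geodesics_diverge[OF X(1) c(1)[OF that(1)] c(1)[OF that(2)]])
         (use \<mu> c(2) that in auto)
    then have "dist s t \<le> dist (f s) (f t) / \<mu>" using \<mu> c(3) that by simp
    then show ?thesis using \<mu> by (simp add: field_simps)
  qed
  have "f ` S \<subseteq> cball x (\<mu> * R) \<inter> X"
  proof (rule image_subsetI)
    fix s assume s: "s \<in> S"
    have "0 \<le> \<mu> * dist x s" using \<mu> by simp
    then have "f s \<in> X" "dist (c s 0) (f s) = \<mu> * dist x s"
      using c(1)[OF s] unfolding isometric_embedding_def f_def by (auto simp: dist_real_def)
    moreover have "\<mu> * dist x s \<le> \<mu> * R" using s S(1) \<mu> by (intro mult_left_mono) auto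
    ultimately show "f s \<in> cball x (\<mu> * R) \<inter> X" using c(2)[OF s] by simp
  qed
  moreover have "\<mu> * \<epsilon> \<le> dist (f s) (f t)" if "s \<in> S" "t \<in> S" "\<epsilon> \<le> dist s t" for s t
    using expand[OF that(1,2)] mult_left_mono[OF that(3), of \<mu>] \<mu> by linarith
  then have "separated (\<mu> * \<epsilon>) (f ` S)" "card (f ` S) = card S"
    using separated_image_expanding[of "\<mu> * \<epsilon>" \<epsilon> S f] \<mu> \<epsilon> S(2) by auto
  ultimately show thesis using that by blast
qed

theorem lemma7:
  fixes X :: "'a::metric_space set"
    and G :: "('g, 'm) monoid_scheme"
    and \<phi> :: "'g \<Rightarrow> 'a \<Rightarrow> 'a"
  assumes "proper_metric X"
    and "geodesically_complete X"
    and "CAT0 X"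
    and "isometric_action G X \<phi>"
    and "cocompact_action G X \<phi>"
  shows "finite_dimensional (top_of_set X)"
proof -
  obtain N where N: "\<And>x S. x \<in> X \<Longrightarrow> S \<subseteq> cball x 3 \<inter> X \<Longrightarrow> separated (1 / 2) S \<Longrightarrow> card S \<le> N"
    by (rule cocompact_packing_bound[OF assms(1,4,5), of "1 / 2" 3]) auto
  have "covering_dim_le (top_of_set X) N"
  proof (rule covering_dim_le_if_packing_bounded)
    fix x r S
    assume x: "x \<in> X" and r: "0 < r" "r \<le> 1"
      and S: "S \<subseteq> cball x (3 * r) \<inter> X" "separated (r / 2) S"
    \<comment> \<open>Rescaling by \<mu> = 1/r takes radius 3r to 3 and scale r/2 to 1/2, whatever r
      is; r \<le> 1 makes this a prolongation.\<close>
    have "1 \<le> 1 / r" "0 < r / 2" using r by auto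
    then obtain T where
      "T \<subseteq> cball x (1 / r * (3 * r)) \<inter> X" "separated (1 / r * (r / 2)) T" "card T = card S"
      by (rule packing_rescaling[OF assms(3,2) x _ S])
    then show "card S \<le> N" using N[OF x, of T] r by simp
  qed
  then show ?thesis unfolding finite_dimensional_def by blast
qed

end
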